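(* Let $n\ge1$, $P_0,\dots,P_n\in\boldsymbol{B_1}$ with $P_n(x)\ne0$ for all $x\in[a,b]$, $f\in\boldsymbol{B_2}$ and $g\in C[a,b]$. Let $R$ be the resolvent kernel of $$h(x,y)=-\sum_{k=0}^{n-1}\frac{P_k(x)}{P_n(x)}\frac{(x-y)^{n-k-1}}{(n-k-1)!}-\int_y^x\frac{f(x,z)}{P_n(x)}\frac{(z-y)^{n-1}}{(n-1)!}\,dz ,$$ and set $$T(x,y)=\frac1{P_n(y)}\Big(\frac{(x-y)^{n-1}}{(n-1)!}+\int_y^x\frac{(x-z)^{n-1}}{(n-1)!}R(z,y)\,dz\Big),\qquad (x,y)\in\Delta .$$ Then the solution $y_2\in D^n[a,b]$ of the integro-differential equation $$\sum_{k=0}^nP_k(x)\,\partial_x^k y_2(x)+\int_a^xf(x,z)\,y_2(z)\,dz=g(x),\qquad \partial_x^ky_2(a)=0\ \ (k=0,1,\dots,n-1),$$ is given by $y_2(x)=\int_a^xT(x,z)\,g(z)\,dz$. Moreover $T$ satisfies: (1) $\sum_{k=0}^nP_k(x)\,\partial_x^kT(x,y)+\int_y^xf(x,z)T(z,y)\,dz=0$ on $\Delta$; (2) $\partial_x^iT(x,y)|_{x=y}=0$ for $i=0,1,\dots,n-2$, and $\partial_x^{n-1}T(x,y)|_{x=y}=1/P_n(x)$.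
   Context: Fix real numbers $a<b$. $\boldsymbol{B_1}$ is the algebra of smooth functions $[a,b]\to\mathbb C$. $\Delta=\{(x,y): a\le y\le x\le b\}$, and $\boldsymbol{B_2}$ is the algebra of smooth functions $\Delta\to\mathbb C$ (all partial derivatives of all orders exist and are continuous on $\Delta$). $D^n[a,b]$ is the space of $n$ times continuously differentiable functions $\phi:[a,b]\to\mathbb C$ with $\partial_x^k\phi(a)=0$ for $k=0,\dots,n-1$. For $h\in\boldsymbol{B_2}$ the resolvent kernel of $h$ is $R=\sum_{i\ge1}h_i\in\boldsymbol{B_2}$ (a uniformly convergent series on $\Delta$), where $h_1=h$ and $h_i(x,y)=\int_y^xh(x,z)h_{i-1}(z,y)\,dz$ for $i\ge2$. "The solution" means that the equation with these conditions at $a$ has exactly one solution in $D^n[a,b]$. *)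

theory Defs
  imports "HOL-Analysis.Analysis"
begin

definition deriv_on :: "real \<Rightarrow> real \<Rightarrow> (real \<Rightarrow> complex) \<Rightarrow> real \<Rightarrow> complex" where
  "deriv_on a b \<phi> = (\<lambda>x. vector_derivative \<phi> (at x within {a..b}))"

definition Cn_on :: "nat \<Rightarrow> real \<Rightarrow> real \<Rightarrow> (real \<Rightarrow> complex) \<Rightarrow> bool" where
  "Cn_on n a b \<phi> \<longleftrightarrow>
     (\<forall>k<n. \<forall>x\<in>{a..b}. (deriv_on a b ^^ k) \<phi> differentiable (at x within {a..b})) \<and>
     (\<forall>k\<le>n. continuous_on {a..b} ((deriv_on a b ^^ k) \<phi>))"

definition B1 :: "real \<Rightarrow> real \<Rightarrow> (real \<Rightarrow> complex) set" where
  "B1 a b = {\<phi>. \<forall>n. Cn_on n a b \<phi>}"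

definition D_space :: "nat \<Rightarrow> real \<Rightarrow> real \<Rightarrow> (real \<Rightarrow> complex) set" where
  "D_space n a b = {\<phi>. Cn_on n a b \<phi> \<and> (\<forall>k<n. (deriv_on a b ^^ k) \<phi> a = 0)}"

definition Delta :: "real \<Rightarrow> real \<Rightarrow> (real \<times> real) set" where
  "Delta a b = {(x, y). a \<le> y \<and> y \<le> x \<and> x \<le> b}"

(* The derivatives are taken along the slices of Delta, hence one-sided on its boundary.
   The slice {y..b} degenerates to a point at the corner (b, b), and {a..x} at (a, a); there the
   derivative condition is void and the value of the partial derivative is the continuous
   extension, which the continuity requirement on all of Delta enforces
   (see has_partial_x_unique and has_partial_y_unique). *)

definition has_partial_x ::
    "real \<Rightarrow> real \<Rightarrow> (real \<Rightarrow> real \<Rightarrow> complex) \<Rightarrow> (real \<Rightarrow> real \<Rightarrow> complex) \<Rightarrow> bool" where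
  "has_partial_x a b F F' \<longleftrightarrow>
     continuous_on (Delta a b) (\<lambda>(x, y). F' x y) \<and>
     (\<forall>(x, y)\<in>Delta a b. ((\<lambda>s. F s y) has_vector_derivative F' x y) (at x within {y..b}))"

definition has_partial_y ::
    "real \<Rightarrow> real \<Rightarrow> (real \<Rightarrow> real \<Rightarrow> complex) \<Rightarrow> (real \<Rightarrow> real \<Rightarrow> complex) \<Rightarrow> bool" where
  "has_partial_y a b F F' \<longleftrightarrow>
     continuous_on (Delta a b) (\<lambda>(x, y). F' x y) \<and>
     (\<forall>(x, y)\<in>Delta a b. ((\<lambda>t. F x t) has_vector_derivative F' x y) (at y within {a..x}))"

lemma has_partial_x_unique:
  assumes "a < b" "has_partial_x a b F G" "has_partial_x a b F G'" "(x, y) \<in> Delta a b"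
  shows "G x y = G' x y"
proof -
  have *: "G x y = G' x y" if xy: "(x, y) \<in> Delta a b" and "y < b" for x y
  proof (rule vector_derivative_unique_within)
    show "at x within {y..b} \<noteq> bot"
      using that by (auto simp: trivial_limit_within islimpt_Icc Delta_def)
    show "((\<lambda>s. F s y) has_vector_derivative G x y) (at x within {y..b})"
      using assms(2) xy by (auto simp: has_partial_x_def)
    show "((\<lambda>s. F s y) has_vector_derivative G' x y) (at x within {y..b})"
      using assms(3) xy by (auto simp: has_partial_x_def)
  qed
  have lim: "((\<lambda>t. H b t) \<longlongrightarrow> H b b) (at b within {a..b})"
    if "continuous_on (Delta a b) (\<lambda>(x, y). H x y)" for H :: "real \<Rightarrow> real \<Rightarrow> complex"
  proof -
    have "continuous_on {a..b} (\<lambda>t. (\<lambda>(x, y). H x y) (b, t))"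
      by (rule continuous_on_compose2[OF that]) (auto intro!: continuous_intros simp: Delta_def)
    then show ?thesis
      using \<open>a < b\<close> by (auto simp: continuous_on)
  qed
  show ?thesis
  proof (cases "y < b")
    case False
    then have [simp]: "x = b" "y = b"
      using assms(4) by (auto simp: Delta_def)
    have "((\<lambda>t. G' b t) \<longlongrightarrow> G b b) (at b within {a..b})"
    proof (rule Lim_transform_eventually)
      show "((\<lambda>t. G b t) \<longlongrightarrow> G b b) (at b within {a..b})"
        using assms(2) by (intro lim) (simp add: has_partial_x_def)
      show "\<forall>\<^sub>F t in at b within {a..b}. G b t = G' b t"
        unfolding eventually_at_filter
        by (rule always_eventually) (auto intro!: * simp: Delta_def)
    qed
    moreover have "((\<lambda>t. G' b t) \<longlongrightarrow> G' b b) (at b within {a..b})"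
      using assms(3) by (intro lim) (simp add: has_partial_x_def)
    moreover have "at b within {a..b} \<noteq> bot"
      using \<open>a < b\<close> by (auto simp: trivial_limit_within islimpt_Icc)
    ultimately show ?thesis
      using tendsto_unique by force
  qed (use * assms(4) in auto)
qed

lemma has_partial_y_unique:
  assumes "a < b" "has_partial_y a b F G" "has_partial_y a b F G'" "(x, y) \<in> Delta a b"
  shows "G x y = G' x y"
proof -
  have *: "G x y = G' x y" if xy: "(x, y) \<in> Delta a b" and "a < x" for x y
  proof (rule vector_derivative_unique_within)
    show "at y within {a..x} \<noteq> bot"
      using that by (auto simp: trivial_limit_within islimpt_Icc Delta_def)
    show "((\<lambda>t. F x t) has_vector_derivative G x y) (at y within {a..x})"
      using assms(2) xy by (auto simp: has_partial_y_def)
    show "((\<lambda>t. F x t) has_vector_derivative G' x y) (at y within {a..x})"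
      using assms(3) xy by (auto simp: has_partial_y_def)
  qed
  have lim: "((\<lambda>s. H s a) \<longlongrightarrow> H a a) (at a within {a..b})"
    if "continuous_on (Delta a b) (\<lambda>(x, y). H x y)" for H :: "real \<Rightarrow> real \<Rightarrow> complex"
  proof -
    have "continuous_on {a..b} (\<lambda>s. (\<lambda>(x, y). H x y) (s, a))"
      by (rule continuous_on_compose2[OF that]) (auto intro!: continuous_intros simp: Delta_def)
    then show ?thesis
      using \<open>a < b\<close> by (auto simp: continuous_on)
  qed
  show ?thesis
  proof (cases "a < x")
    case False
    then have [simp]: "x = a" "y = a"
      using assms(4) by (auto simp: Delta_def)
    have "((\<lambda>s. G' s a) \<longlongrightarrow> G a a) (at a within {a..b})"
    proof (rule Lim_transform_eventually)
      show "((\<lambda>s. G s a) \<longlongrightarrow> G a a) (at a within {a..b})"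
        using assms(2) by (intro lim) (simp add: has_partial_y_def)
      show "\<forall>\<^sub>F s in at a within {a..b}. G s a = G' s a"
        unfolding eventually_at_filter
        by (rule always_eventually) (auto intro!: * simp: Delta_def)
    qed
    moreover have "((\<lambda>s. G' s a) \<longlongrightarrow> G' a a) (at a within {a..b})"
      using assms(3) by (intro lim) (simp add: has_partial_y_def)
    moreover have "at a within {a..b} \<noteq> bot"
      using \<open>a < b\<close> by (auto simp: trivial_limit_within islimpt_Icc)
    ultimately show ?thesis
      using tendsto_unique by force
  qed (use * assms(4) in auto)
qed

primrec Ck_Delta :: "nat \<Rightarrow> real \<Rightarrow> real \<Rightarrow> (real \<Rightarrow> real \<Rightarrow> complex) \<Rightarrow> bool" where
  "Ck_Delta 0 a b F \<longleftrightarrow> continuous_on (Delta a b) (\<lambda>(x, y). F x y)"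
| "Ck_Delta (Suc k) a b F \<longleftrightarrow>
     continuous_on (Delta a b) (\<lambda>(x, y). F x y) \<and>
     (\<exists>F\<^sub>x F\<^sub>y. has_partial_x a b F F\<^sub>x \<and> has_partial_y a b F F\<^sub>y \<and>
        Ck_Delta k a b F\<^sub>x \<and> Ck_Delta k a b F\<^sub>y)"

definition B2 :: "real \<Rightarrow> real \<Rightarrow> (real \<Rightarrow> real \<Rightarrow> complex) set" where
  "B2 a b = {F. \<forall>k. Ck_Delta k a b F}"

(* Indexed from 0: iterated_kernel h i is the (i+1)-st iterated kernel of h. *)

primrec iterated_kernel ::
    "(real \<Rightarrow> real \<Rightarrow> complex) \<Rightarrow> nat \<Rightarrow> real \<Rightarrow> real \<Rightarrow> complex" where
  "iterated_kernel h 0 = h"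
| "iterated_kernel h (Suc i) = (\<lambda>x y. integral {y..x} (\<lambda>z. h x z * iterated_kernel h i z y))"

definition resolvent_kernel :: "(real \<Rightarrow> real \<Rightarrow> complex) \<Rightarrow> real \<Rightarrow> real \<Rightarrow> complex" where
  "resolvent_kernel h x y = (\<Sum>i. iterated_kernel h i x y)"

definition ide_kernel ::
    "nat \<Rightarrow> (nat \<Rightarrow> real \<Rightarrow> complex) \<Rightarrow> (real \<Rightarrow> real \<Rightarrow> complex) \<Rightarrow> real \<Rightarrow> real \<Rightarrow> complex" where
  "ide_kernel n P f x y =
     - (\<Sum>k<n. P k x / P n x * complex_of_real ((x - y) ^ (n - k - 1) / fact (n - k - 1)))
     - integral {y..x} (\<lambda>z. f x z / P n x * complex_of_real ((z - y) ^ (n - 1) / fact (n - 1)))"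

definition T_kernel ::
    "nat \<Rightarrow> (nat \<Rightarrow> real \<Rightarrow> complex) \<Rightarrow> (real \<Rightarrow> real \<Rightarrow> complex) \<Rightarrow> real \<Rightarrow> real \<Rightarrow> complex" where
  "T_kernel n P f x y =
     1 / P n y *
       (complex_of_real ((x - y) ^ (n - 1) / fact (n - 1)) +
        integral {y..x} (\<lambda>z. complex_of_real ((x - z) ^ (n - 1) / fact (n - 1)) *
                              resolvent_kernel (ide_kernel n P f) z y))"

definition is_ide_solution ::
    "real \<Rightarrow> real \<Rightarrow> nat \<Rightarrow> (nat \<Rightarrow> real \<Rightarrow> complex) \<Rightarrow> (real \<Rightarrow> real \<Rightarrow> complex) \<Rightarrow>
     (real \<Rightarrow> complex) \<Rightarrow> (real \<Rightarrow> complex) \<Rightarrow> bool" where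
  "is_ide_solution a b n P f g \<phi> \<longleftrightarrow>
     \<phi> \<in> D_space n a b \<and>
     (\<forall>x\<in>{a..b}.
        (\<Sum>k\<le>n. P k x * (deriv_on a b ^^ k) \<phi> x) + integral {a..x} (\<lambda>z. f x z * \<phi> z) = g x)"

end

theory Submission
  imports Defs
begin

text \<open>
  A function with \<open>n\<close> vanishing initial derivatives is the \<open>n\<close>-fold integral of its \<open>n\<close>-th
  derivative \<open>u\<close>, by Taylor's formula (\<open>D_space_taylor_derivs\<close>), and conversely every continuous
  \<open>u\<close> arises in this way (\<open>taylor_derivs_deriv_on\<close>). Since \<open>n\<close>-fold integration is the integral
  operator with kernel \<open>K(x, y) = (x - y)\<^sup>n\<^sup>-\<^sup>1 / (n - 1)!\<close>, writing the equation in terms of \<open>u\<close>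
  turns its left-hand side into \<open>P\<^sub>n (u - h u)\<close> (\<open>ide_operator_taylor_derivs\<close>), where \<open>h u\<close> is the
  function \<open>x \<mapsto> \<integral>\<^sub>a\<^sup>x h(x, z) u(z) dz\<close>. So the problem is equivalent to the Volterra equation
  \<open>u = G + h u\<close> with \<open>G = g / P\<^sub>n\<close>.

  That equation has at most one continuous solution, because the iterated kernels are bounded by
  the terms of an exponential series (\<open>volterra_homogeneous_unique\<close>). It is solved by
  \<open>u = G + R G\<close>, because the Neumann series \<open>R\<close> satisfies \<open>R = h + h R\<close> (\<open>resolvent_equation\<close>,
  \<open>volterra_resolvent\<close>). The \<open>n\<close>-fold integral of this \<open>u\<close> is \<open>K (G + R G) = (K + K R) G\<close>, and
  \<open>(K + K R)(x, y) / P\<^sub>n(y)\<close> is precisely \<open>T(x, y)\<close> (\<open>volterra_T_kernel\<close>).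

  The properties of \<open>T\<close> follow from the same reduction with base point \<open>y\<close> in place of \<open>a\<close>. Up to
  the factor \<open>1 / P\<^sub>n(y)\<close>, \<open>T(\<cdot>, y)\<close> is the sum of the power \<open>K(\<cdot>, y)\<close> and the \<open>n\<close>-fold integral
  of \<open>R(\<cdot>, y)\<close>. The integro-differential operator sends the former to \<open>-P\<^sub>n h\<close> and the latter to
  \<open>P\<^sub>n (R - h R)\<close>, which add up to zero (\<open>T_deriv_equation\<close>). On the diagonal the integrals
  vanish and the power alone gives the initial values.
\<close>

section \<open>Volterra integral operators\<close>
abbreviation continuous_kernel :: "real \<Rightarrow> real \<Rightarrow> (real \<Rightarrow> real \<Rightarrow> complex) \<Rightarrow> bool" where
  "continuous_kernel a b h \<equiv> continuous_on (Delta a b) (\<lambda>(x, y). h x y)"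

definition volterra ::
    "(real \<Rightarrow> real \<Rightarrow> complex) \<Rightarrow> real \<Rightarrow> (real \<Rightarrow> complex) \<Rightarrow> real \<Rightarrow> complex" where
  "volterra h c u x = integral {c..x} (\<lambda>z. h x z * u z)"

text \<open>The base point of the inner integral operator is the second argument of the kernel, so
  that a kernel with that argument fixed is just another function to which the operator is
  applied; facts about composed kernels are then instances of facts about functions.\<close>
definition kernel_comp ::
    "(real \<Rightarrow> real \<Rightarrow> complex) \<Rightarrow> (real \<Rightarrow> real \<Rightarrow> complex) \<Rightarrow> real \<Rightarrow> real \<Rightarrow> complex" where
  "kernel_comp h k x y = volterra h y (\<lambda>z. k z y) x"

lemma continuous_kernel_compose:
  assumes "continuous_kernel a b h" "continuous_on S p" "continuous_on S q"
    and "\<And>s. s \<in> S \<Longrightarrow> a \<le> q s \<and> q s \<le> p s \<and> p s \<le> b"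
  shows "continuous_on S (\<lambda>s. h (p s) (q s))"
proof -
  have "continuous_on S (\<lambda>s. (\<lambda>(x, y). h x y) (p s, q s))"
    by (rule continuous_on_compose2[OF assms(1)])
      (use assms in \<open>auto intro!: continuous_intros simp: Delta_def\<close>)
  then show ?thesis by simp
qed

lemma continuous_kernel_subset:
  "continuous_kernel a b h \<Longrightarrow> a \<le> c \<Longrightarrow> d \<le> b \<Longrightarrow> continuous_kernel c d h"
  by (erule continuous_on_subset) (auto simp: Delta_def)

lemma compact_Delta: "compact (Delta a b)"
proof -
  have "Delta a b = cbox (a, a) (b, b) \<inter> {p. snd p \<le> fst p}"
    by (auto simp: Delta_def)
  moreover have "closed {p::real \<times> real. snd p \<le> fst p}"
    by (intro closed_Collect_le continuous_intros)
  ultimately show ?thesis by (metis compact_Int_closed compact_cbox)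
qed

lemma integral_unit_interval:
  fixes F :: "real \<Rightarrow> complex"
  assumes "p \<le> q" "continuous_on {p..q} F"
  shows "integral {p..q} F = of_real (q - p) * integral {0..1} (\<lambda>t. F (p + t * (q - p)))"
proof (cases "p = q")
  case False
  then have "0 < q - p" using assms by simp
  have "(F has_integral integral {p..q} F) (cbox p q)"
    using assms by (auto intro!: integrable_integral integrable_continuous_real)
  from has_integral_affinity'[OF this \<open>0 < q - p\<close>, of p]
  have "((\<lambda>t. F (p + t * (q - p))) has_integral integral {p..q} F /\<^sub>R (q - p)) {0..1}"
    using \<open>0 < q - p\<close> by (simp add: ac_simps)
  then have "integral {0..1} (\<lambda>t. F (p + t * (q - p))) = integral {p..q} F /\<^sub>R (q - p)"
    by (rule integral_unique)
  then show ?thesis using False by (simp add: scaleR_conv_of_real field_simps)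
qed simp

text \<open>Rescaling the interval of integration to the unit interval moves the variable limits into
  the integrand, and there only continuous dependence on a parameter is left to use.\<close>
lemma continuous_on_integral_variable_limits:
  fixes F :: "'a::topological_space \<Rightarrow> real \<Rightarrow> complex"
  assumes F: "continuous_on {(s, z). s \<in> S \<and> z \<in> {p s..q s}} (\<lambda>(s, z). F s z)"
    and p: "continuous_on S p" and q: "continuous_on S q" and le: "\<And>s. s \<in> S \<Longrightarrow> p s \<le> q s"
  shows "continuous_on S (\<lambda>s. integral {p s..q s} (F s))"
proof -
  have in_seg: "p s \<le> p s + t * (q s - p s) \<and> p s + t * (q s - p s) \<le> q s"
    if "s \<in> S" "0 \<le> t" "t \<le> 1" for s t
    using le[OF that(1)] that mult_left_le_one_le[of "q s - p s" t] by (auto simp: mult.commute)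
  have fst: "continuous_on (S \<times> {0..1::real}) (\<lambda>r. p (fst r))"
      "continuous_on (S \<times> {0..1::real}) (\<lambda>r. q (fst r))"
    by (auto intro!: continuous_on_compose2[OF p] continuous_on_compose2[OF q] continuous_intros)
  have "continuous_on (S \<times> cbox 0 1)
      (\<lambda>r. (\<lambda>(s, z). F s z) (fst r, p (fst r) + snd r * (q (fst r) - p (fst r))))"
    by (rule continuous_on_compose2[OF F])
      (use in_seg in \<open>auto intro!: continuous_intros fst\<close>)
  then have "continuous_on (S \<times> cbox 0 1) (\<lambda>(s, t). F s (p s + t * (q s - p s)))"
    by (simp add: case_prod_beta)
  then have "continuous_on S (\<lambda>s. integral (cbox 0 1) (\<lambda>t. F s (p s + t * (q s - p s))))"
    by (rule integral_continuous_on_param)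
  then have "continuous_on S (\<lambda>s. of_real (q s - p s) *
      integral {0..1} (\<lambda>t. F s (p s + t * (q s - p s))))"
    using p q by (auto intro!: continuous_intros)
  moreover have "integral {p s..q s} (F s) = of_real (q s - p s) *
      integral {0..1} (\<lambda>t. F s (p s + t * (q s - p s)))" if "s \<in> S" for s
  proof (rule integral_unit_interval[OF le[OF that]])
    have "continuous_on {p s..q s} (\<lambda>z. (\<lambda>(s, z). F s z) (s, z))"
      by (rule continuous_on_compose2[OF F]) (use that in \<open>auto intro!: continuous_intros\<close>)
    then show "continuous_on {p s..q s} (F s)" by simp
  qed
  ultimately show ?thesis by simp
qed

text \<open>Fubini's theorem for the Lebesgue integral, applied to the function that vanishes outside
  the triangle; continuity on a compact set makes it integrable.\<close>
lemma integral_triangle_swap: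
  assumes "continuous_kernel c x F"
  shows "integral {c..x} (\<lambda>w. integral {c..w} (\<lambda>z. F w z)) =
    integral {c..x} (\<lambda>z. integral {z..x} (\<lambda>w. F w z))"
proof -
  define G where "G w z = indicator (Delta c x) (w, z) *\<^sub>R F w z" for w z
  have eq: "(LBINT z:{p..q}. H z) = integral {p..q} H"
    if "continuous_on {p..q} H" for p q and H :: "real \<Rightarrow> complex"
    using that by (intro set_borel_integral_eq_integral borel_integrable_atLeastAtMost')
  have slice1: "continuous_on {c..w} (\<lambda>z. F w z)" if "c \<le> w" "w \<le> x" for w
    using that by (intro continuous_kernel_compose[OF assms]) (auto intro!: continuous_intros)
  have slice2: "continuous_on {z..x} (\<lambda>w. F w z)" if "c \<le> z" "z \<le> x" for z
    using that by (intro continuous_kernel_compose[OF assms]) (auto intro!: continuous_intros)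
  have cont1: "continuous_on {c..x} (\<lambda>w. integral {c..w} (\<lambda>z. F w z))"
    by (rule continuous_on_integral_variable_limits)
      (auto intro!: continuous_intros continuous_on_subset[OF assms] simp: Delta_def)
  have cont2: "continuous_on {c..x} (\<lambda>z. integral {z..x} (\<lambda>w. F w z))"
    by (rule continuous_on_integral_variable_limits)
      (auto intro!: continuous_intros continuous_kernel_compose[OF assms]
        simp: Delta_def case_prod_beta)
  have inner1: "(LBINT z. G w z) = indicator {c..x} w *\<^sub>R integral {c..w} (\<lambda>z. F w z)" for w
  proof (cases "w \<in> {c..x}")
    case True
    then have "(LBINT z. G w z) = (LBINT z:{c..w}. F w z)"
      unfolding set_lebesgue_integral_def G_def
      by (intro Bochner_Integration.integral_cong) (auto simp: Delta_def indicator_def)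
    then show ?thesis using True eq[OF slice1] by simp
  next
    case False
    then have "G w z = 0" for z by (auto simp: G_def Delta_def indicator_def)
    then show ?thesis using False by simp
  qed
  have inner2: "(LBINT w. G w z) = indicator {c..x} z *\<^sub>R integral {z..x} (\<lambda>w. F w z)" for z
  proof (cases "z \<in> {c..x}")
    case True
    then have "(LBINT w. G w z) = (LBINT w:{z..x}. F w z)"
      unfolding set_lebesgue_integral_def G_def
      by (intro Bochner_Integration.integral_cong) (auto simp: Delta_def indicator_def)
    then show ?thesis using True eq[OF slice2] by simp
  next
    case False
    then have "G w z = 0" for w by (auto simp: G_def Delta_def indicator_def)
    then show ?thesis using False by simp
  qed
  from borel_integrable_compact[OF compact_Delta assms]
  have "integrable (lborel \<Otimes>\<^sub>M lborel)
      (\<lambda>p. indicator (Delta c x) p *\<^sub>R (case p of (w, z) \<Rightarrow> F w z))"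
    by (simp add: lborel_prod)
  also have "(\<lambda>p. indicator (Delta c x) p *\<^sub>R (case p of (w, z) \<Rightarrow> F w z)) = case_prod G"
    by (auto simp: G_def fun_eq_iff)
  finally have "integrable (lborel \<Otimes>\<^sub>M lborel) (case_prod G)" .
  from lborel_pair.Fubini_integral[OF this]
  have "(LBINT w:{c..x}. integral {c..w} (\<lambda>z. F w z)) =
      (LBINT z:{c..x}. integral {z..x} (\<lambda>w. F w z))"
    by (simp add: inner1 inner2 set_lebesgue_integral_def)
  then show ?thesis by (simp add: eq[OF cont1] eq[OF cont2])
qed

lemma continuous_on_volterra:
  assumes "continuous_kernel c b h" "continuous_on {c..b} u"
  shows "continuous_on {c..b} (volterra h c u)"
  unfolding volterra_def
  by (rule continuous_on_integral_variable_limits)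
    (auto intro!: continuous_intros continuous_kernel_compose[OF assms(1)]
      continuous_on_compose2[OF assms(2)] simp: case_prod_beta)

lemma continuous_kernel_comp:
  assumes h: "continuous_kernel a b h" and k: "continuous_kernel a b k"
  shows "continuous_kernel a b (kernel_comp h k)"
proof -
  have "continuous_on (Delta a b)
      (\<lambda>s. integral {snd s..fst s} (\<lambda>z. h (fst s) z * k z (snd s)))"
    by (rule continuous_on_integral_variable_limits)
      (auto intro!: continuous_intros continuous_kernel_compose[OF h]
        continuous_kernel_compose[OF k] simp: Delta_def case_prod_beta)
  then show ?thesis
    by (simp add: kernel_comp_def volterra_def case_prod_beta)
qed

lemma volterra_integrable:
  assumes "continuous_kernel c b h" "continuous_on {c..b} u" "x \<le> b"
  shows "(\<lambda>z. h x z * u z) integrable_on {c..x}"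
  using assms(3)
  by (intro integrable_continuous_real continuous_intros continuous_kernel_compose[OF assms(1)]
      continuous_on_subset[OF assms(2)]) auto

lemma volterra_cong:
  assumes "\<And>z. z \<in> {c..x} \<Longrightarrow> u z = v z"
  shows "volterra h c u x = volterra h c v x"
  unfolding volterra_def using assms by (intro integral_cong) simp

lemma volterra_add:
  assumes "continuous_kernel c b h" "continuous_on {c..b} u" "continuous_on {c..b} v" "x \<le> b"
  shows "volterra h c (\<lambda>z. u z + v z) x = volterra h c u x + volterra h c v x"
  unfolding volterra_def ring_distribs
  using assms by (intro Henstock_Kurzweil_Integration.integral_add volterra_integrable)

lemma volterra_diff:
  assumes "continuous_kernel c b h" "continuous_on {c..b} u" "continuous_on {c..b} v" "x \<le> b"
  shows "volterra h c (\<lambda>z. u z - v z) x = volterra h c u x - volterra h c v x"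
  unfolding volterra_def ring_distribs
  using assms by (intro Henstock_Kurzweil_Integration.integral_diff volterra_integrable)

lemma volterra_add_kernel:
  assumes "continuous_kernel c b h" "continuous_kernel c b k" "continuous_on {c..b} u" "x \<le> b"
  shows "volterra (\<lambda>x z. h x z + k x z) c u x = volterra h c u x + volterra k c u x"
  unfolding volterra_def ring_distribs
  using assms by (intro Henstock_Kurzweil_Integration.integral_add volterra_integrable)

text \<open>Operators compose as their kernels do. Every exchange of integrals in the proof is an
  instance of this.\<close>
lemma volterra_volterra:
  assumes h: "continuous_kernel c b h" and k: "continuous_kernel c b k"
    and u: "continuous_on {c..b} u" and x: "x \<le> b"
  shows "volterra h c (volterra k c u) x = volterra (kernel_comp h k) c u x"
proof -
  have "continuous_kernel c x (\<lambda>w z. h x w * (k w z * u z))"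
    using x by (auto intro!: continuous_intros continuous_kernel_compose[OF h]
        continuous_kernel_compose[OF k] continuous_on_compose2[OF u]
        simp: Delta_def case_prod_beta)
  from integral_triangle_swap[OF this]
  have "integral {c..x} (\<lambda>w. h x w * integral {c..w} (\<lambda>z. k w z * u z)) =
      integral {c..x} (\<lambda>z. integral {z..x} (\<lambda>w. (h x w * k w z) * u z))"
    by (simp add: mult.assoc)
  then show ?thesis
    by (simp add: volterra_def kernel_comp_def)
qed

section \<open>Repeated integration\<close>
definition taylor_kernel :: "nat \<Rightarrow> real \<Rightarrow> real \<Rightarrow> complex" where
  "taylor_kernel j x y = complex_of_real ((x - y) ^ j / fact j)"

lemma power_fact_has_derivative:
  fixes x y :: real
  shows "((\<lambda>s. (s - y) ^ Suc j / fact (Suc j)) has_real_derivative (x - y) ^ j / fact j)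
    (at x within S)"
proof -
  have "((\<lambda>s. (s - y) ^ Suc j / fact (Suc j)) has_real_derivative
      of_nat (Suc j) * (x - y) ^ j / fact (Suc j)) (at x within S)"
    by (rule derivative_eq_intros refl | simp)+
  moreover have "of_nat (Suc j) * (x - y) ^ j / fact (Suc j) = (x - y) ^ j / fact j"
    by (simp add: fact_Suc del: of_nat_Suc)
  ultimately show ?thesis by (simp only:)
qed

lemma has_integral_power_fact:
  fixes x y :: real
  assumes "y \<le> x"
  shows "((\<lambda>z. (z - y) ^ j / fact j) has_integral (x - y) ^ Suc j / fact (Suc j)) {y..x}"
proof -
  have "((\<lambda>z. (z - y) ^ j / fact j) has_integral
      (x - y) ^ Suc j / fact (Suc j) - (y - y) ^ Suc j / fact (Suc j)) {y..x}"
    by (rule fundamental_theorem_of_calculus[OF assms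
          power_fact_has_derivative[unfolded has_real_derivative_iff_has_vector_derivative]])
  then show ?thesis by simp
qed

lemma continuous_taylor_kernel: "continuous_kernel a b (taylor_kernel j)"
  by (auto simp: taylor_kernel_def case_prod_beta intro!: continuous_intros)

lemma taylor_kernel_0 [simp]: "taylor_kernel 0 x y = 1"
  by (simp add: taylor_kernel_def)

lemma taylor_kernel_diagonal: "taylor_kernel j x x = (if j = 0 then 1 else 0)"
  by (simp add: taylor_kernel_def)

lemma integral_taylor_kernel:
  assumes "y \<le> x"
  shows "integral {y..x} (\<lambda>z. taylor_kernel j z y) = taylor_kernel (Suc j) x y"
  using has_integral_linear[OF has_integral_power_fact[OF assms] bounded_linear_of_real]
  unfolding taylor_kernel_def o_def by (rule integral_unique)

lemma taylor_kernel_has_derivative: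
  "((\<lambda>s. taylor_kernel (Suc j) s y) has_vector_derivative taylor_kernel j x y) (at x within S)"
  unfolding taylor_kernel_def
  by (intro has_vector_derivative_of_real power_fact_has_derivative)

text \<open>The kernel \<open>(x - y)\<^sup>j / j!\<close> represents repeated integration: composing the constant kernel
  1 with it raises \<open>j\<close> by one.\<close>
lemma volterra_taylor_Suc:
  assumes "continuous_on {c..b} u" "x \<le> b"
  shows "volterra (taylor_kernel (Suc j)) c u x =
    integral {c..x} (volterra (taylor_kernel j) c u)"
proof -
  have "integral {c..x} (volterra (taylor_kernel j) c u) =
      volterra (taylor_kernel 0) c (volterra (taylor_kernel j) c u) x"
    by (simp add: volterra_def[abs_def])
  also have "\<dots> = volterra (kernel_comp (taylor_kernel 0) (taylor_kernel j)) c u x"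
    using assms by (intro volterra_volterra continuous_taylor_kernel)
  also have "\<dots> = volterra (taylor_kernel (Suc j)) c u x"
    unfolding volterra_def
    by (intro integral_cong) (simp add: kernel_comp_def volterra_def integral_taylor_kernel)
  finally show ?thesis ..
qed

lemma volterra_taylor_has_derivative:
  assumes "continuous_on {c..b} u" "x \<in> {c..b}"
  shows "(volterra (taylor_kernel (Suc j)) c u has_vector_derivative
      volterra (taylor_kernel j) c u x) (at x within {c..b})"
    and "(volterra (taylor_kernel 0) c u has_vector_derivative u x) (at x within {c..b})"
proof -
  have "((\<lambda>s. integral {c..s} (volterra (taylor_kernel j) c u)) has_vector_derivative
      volterra (taylor_kernel j) c u x) (at x within {c..b})"
    using assms by (intro integral_has_vector_derivative continuous_on_volterra
        continuous_taylor_kernel)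
  then show "(volterra (taylor_kernel (Suc j)) c u has_vector_derivative
      volterra (taylor_kernel j) c u x) (at x within {c..b})"
    by (rule has_vector_derivative_transform[rotated 2])
      (use assms in \<open>auto simp: volterra_taylor_Suc[of c b]\<close>)
  show "(volterra (taylor_kernel 0) c u has_vector_derivative u x) (at x within {c..b})"
    using integral_has_vector_derivative[OF assms] by (simp add: volterra_def[abs_def])
qed

section \<open>The resolvent kernel\<close>
lemma iterated_kernel_Suc: "iterated_kernel h (Suc i) = kernel_comp h (iterated_kernel h i)"
  by (simp add: kernel_comp_def volterra_def fun_eq_iff)

lemma continuous_iterated_kernel:
  assumes "continuous_kernel a b h"
  shows "continuous_kernel a b (iterated_kernel h i)"
  by (induction i) (use assms in \<open>auto simp: iterated_kernel_Suc continuous_kernel_comp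
      simp del: iterated_kernel.simps(2)\<close>)

text \<open>Each further integration over the triangle contributes another power of \<open>x - y\<close>, hence
  the factorial, which makes the Neumann series converge for kernels of any size.\<close>
lemma iterated_kernel_bound:
  assumes h: "continuous_kernel a b h"
    and M: "\<And>x y. (x, y) \<in> Delta a b \<Longrightarrow> norm (h x y) \<le> M" and "0 \<le> M"
    and "(x, y) \<in> Delta a b"
  shows "norm (iterated_kernel h i x y) \<le> M ^ Suc i * ((x - y) ^ i / fact i)"
  using assms(4)
proof (induction i arbitrary: x)
  case 0
  then show ?case using M by simp
next
  case (Suc i)
  then have xy: "a \<le> y" "y \<le> x" "x \<le> b" by (auto simp: Delta_def)
  have int: "((\<lambda>z. M * (M ^ Suc i * ((z - y) ^ i / fact i))) has_integral
      M * (M ^ Suc i * ((x - y) ^ Suc i / fact (Suc i)))) {y..x}"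
    by (intro has_integral_mult_right has_integral_power_fact xy)
  have "norm (iterated_kernel h (Suc i) x y) \<le>
      integral {y..x} (\<lambda>z. M * (M ^ Suc i * ((z - y) ^ i / fact i)))"
    unfolding iterated_kernel.simps
  proof (rule integral_norm_bound_integral)
    show "(\<lambda>z. h x z * iterated_kernel h i z y) integrable_on {y..x}"
      using xy by (intro integrable_continuous_real continuous_intros
          continuous_kernel_compose[OF h]
          continuous_kernel_compose[OF continuous_iterated_kernel[OF h]]) auto
    show "norm (h x z * iterated_kernel h i z y) \<le> M * (M ^ Suc i * ((z - y) ^ i / fact i))"
      if "z \<in> {y..x}" for z
      unfolding norm_mult using that xy \<open>0 \<le> M\<close>
      by (intro mult_mono M Suc.IH) (auto simp: Delta_def)
  qed (use int in \<open>rule has_integral_integrable\<close>)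
  also have "\<dots> = M ^ Suc (Suc i) * ((x - y) ^ Suc i / fact (Suc i))"
    using integral_unique[OF int] by (simp add: mult.assoc)
  finally show ?case .
qed

lemma iterated_kernel_summable_bound:
  assumes h: "continuous_kernel a b h"
  obtains B where "summable B"
    "\<And>i x y. (x, y) \<in> Delta a b \<Longrightarrow> norm (iterated_kernel h i x y) \<le> B i"
proof -
  from compact_imp_bounded[OF compact_continuous_image[OF h compact_Delta]]
  obtain M where M: "0 < M" "\<And>x y. (x, y) \<in> Delta a b \<Longrightarrow> norm (h x y) \<le> M"
    unfolding bounded_pos by force
  show thesis
  proof
    show "summable (\<lambda>i. M * (inverse (fact i) * (M * (b - a)) ^ i))"
      by (intro summable_mult summable_exp)
    show "norm (iterated_kernel h i x y) \<le> M * (inverse (fact i) * (M * (b - a)) ^ i)"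
      if "(x, y) \<in> Delta a b" for i x y
    proof -
      have "norm (iterated_kernel h i x y) \<le> M ^ Suc i * ((x - y) ^ i / fact i)"
        using iterated_kernel_bound[OF h M(2)] M(1) that by simp
      also have "\<dots> \<le> M ^ Suc i * ((b - a) ^ i / fact i)"
        using M(1) that
        by (intro mult_left_mono divide_right_mono power_mono) (auto simp: Delta_def)
      also have "\<dots> = M * (inverse (fact i) * (M * (b - a)) ^ i)"
        by (simp add: divide_inverse power_mult_distrib)
      finally show ?thesis .
    qed
  qed
qed

lemma continuous_resolvent_kernel:
  assumes h: "continuous_kernel a b h"
  shows "continuous_kernel a b (resolvent_kernel h)"
proof -
  obtain B where B: "summable B"
    "\<And>i x y. (x, y) \<in> Delta a b \<Longrightarrow> norm (iterated_kernel h i x y) \<le> B i"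
    using iterated_kernel_summable_bound[OF h] by blast
  have "uniform_limit (Delta a b) (\<lambda>n p. \<Sum>i<n. case p of (x, y) \<Rightarrow> iterated_kernel h i x y)
      (\<lambda>p. \<Sum>i. case p of (x, y) \<Rightarrow> iterated_kernel h i x y) sequentially"
    using B by (intro Weierstrass_m_test[where M = B]) auto
  then have "continuous_on (Delta a b) (\<lambda>p. \<Sum>i. case p of (x, y) \<Rightarrow> iterated_kernel h i x y)"
    by (rule uniform_limit_theorem[rotated])
      (intro always_eventually allI continuous_on_sum continuous_iterated_kernel h
        trivial_limit_sequentially)+
  then show ?thesis
    by (simp add: resolvent_kernel_def case_prod_beta)
qed

text \<open>Integrating the uniformly convergent series against \<open>h\<close> term by term shifts the index of
  the iterated kernels by one, so that only the first term is lost.\<close>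
lemma resolvent_equation:
  assumes h: "continuous_kernel a b h" and "(x, y) \<in> Delta a b"
  shows "resolvent_kernel h x y = h x y + kernel_comp h (resolvent_kernel h) x y"
proof -
  have xy: "a \<le> y" "y \<le> x" "x \<le> b" using assms(2) by (auto simp: Delta_def)
  obtain B where B: "summable B"
    "\<And>i x y. (x, y) \<in> Delta a b \<Longrightarrow> norm (iterated_kernel h i x y) \<le> B i"
    using iterated_kernel_summable_bound[OF h] by blast
  have summable: "summable (\<lambda>i. iterated_kernel h i z y)" if "z \<in> {y..x}" for z
    by (rule summable_comparison_test'[OF B(1), of 0])
      (use that xy in \<open>auto intro!: B(2) simp: Delta_def\<close>)
  have cont: "continuous_on {y..x} (\<lambda>z. h x z * iterated_kernel h i z y)" for i
    using xy by (intro continuous_intros continuous_kernel_compose[OF h]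
        continuous_kernel_compose[OF continuous_iterated_kernel[OF h]]) auto
  have "bounded ((\<lambda>z. h x z) ` {y..x})"
    using xy by (intro compact_imp_bounded compact_continuous_image
        continuous_kernel_compose[OF h] continuous_intros) auto
  then obtain M where M: "0 < M" "\<And>z. z \<in> {y..x} \<Longrightarrow> norm (h x z) \<le> M"
    unfolding bounded_pos by auto
  have "uniform_limit {y..x} (\<lambda>n z. \<Sum>i<n. h x z * iterated_kernel h i z y)
      (\<lambda>z. \<Sum>i. h x z * iterated_kernel h i z y) sequentially"
  proof (rule Weierstrass_m_test)
    show "norm (h x z * iterated_kernel h i z y) \<le> M * B i" if "z \<in> {y..x}" for i z
      unfolding norm_mult using that M xy
      by (intro mult_mono B(2)) (auto simp: Delta_def)
  qed (use B(1) in \<open>rule summable_mult\<close>)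
  then obtain I J where
    I: "\<And>n. ((\<lambda>z. \<Sum>i<n. h x z * iterated_kernel h i z y) has_integral I n) {y..x}"
    and J: "((\<lambda>z. \<Sum>i. h x z * iterated_kernel h i z y) has_integral J) {y..x}"
    and lim: "I \<longlonglongrightarrow> J"
    by (rule uniform_limit_integral) (auto intro!: continuous_on_sum cont)
  have "I = (\<lambda>n. \<Sum>i<n. iterated_kernel h (Suc i) x y)"
  proof
    fix n
    have "((\<lambda>z. \<Sum>i<n. h x z * iterated_kernel h i z y) has_integral
        (\<Sum>i<n. iterated_kernel h (Suc i) x y)) {y..x}"
      by (auto intro!: has_integral_sum integrable_integral integrable_continuous_real cont)
    then show "I n = (\<Sum>i<n. iterated_kernel h (Suc i) x y)"
      using I has_integral_unique by blast
  qed
  with lim have "(\<lambda>i. iterated_kernel h (Suc i) x y) sums J"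
    by (simp only: sums_def)
  then have "(\<lambda>i. iterated_kernel h i x y) sums (J + iterated_kernel h 0 x y)"
    by (rule sums_Suc)
  moreover have "((\<lambda>z. h x z * resolvent_kernel h z y) has_integral J) {y..x}"
    using J by (rule has_integral_eq[rotated])
      (simp add: resolvent_kernel_def suminf_mult summable)
  then have "J = kernel_comp h (resolvent_kernel h) x y"
    by (simp add: kernel_comp_def volterra_def integral_unique)
  ultimately show ?thesis
    by (simp add: resolvent_kernel_def sums_unique[symmetric])
qed

text \<open>In other words, \<open>v + R v\<close> solves the integral equation \<open>u = v + h u\<close>.\<close>
lemma volterra_resolvent:
  assumes h: "continuous_kernel c b h" and v: "continuous_on {c..b} v" and x: "x \<in> {c..b}"
  shows "volterra (resolvent_kernel h) c v x =
    volterra h c (\<lambda>z. v z + volterra (resolvent_kernel h) c v z) x"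
proof -
  note R = continuous_resolvent_kernel[OF h]
  have "volterra (resolvent_kernel h) c v x =
      volterra (\<lambda>x z. h x z + kernel_comp h (resolvent_kernel h) x z) c v x"
    unfolding volterra_def using x
    by (intro integral_cong) (simp add: resolvent_equation[OF h] Delta_def)
  also have "\<dots> = volterra h c v x + volterra (kernel_comp h (resolvent_kernel h)) c v x"
    using x by (intro volterra_add_kernel[OF h continuous_kernel_comp[OF h R] v]) simp
  also have "volterra (kernel_comp h (resolvent_kernel h)) c v x =
      volterra h c (volterra (resolvent_kernel h) c v) x"
    using x by (intro volterra_volterra[OF h R v, symmetric]) simp
  also have "volterra h c v x + \<dots> =
      volterra h c (\<lambda>z. v z + volterra (resolvent_kernel h) c v z) x"
    using x by (intro volterra_add[OF h v continuous_on_volterra[OF R v], symmetric]) simp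
  finally show ?thesis .
qed

text \<open>A solution is reproduced by all iterated kernels, and these tend to zero uniformly.\<close>
lemma volterra_homogeneous_unique:
  assumes h: "continuous_kernel c b h" and w: "continuous_on {c..b} w"
    and eq: "\<And>x. x \<in> {c..b} \<Longrightarrow> w x = volterra h c w x" and x: "x \<in> {c..b}"
  shows "w x = 0"
proof -
  obtain B where B: "summable B"
    "\<And>i x y. (x, y) \<in> Delta c b \<Longrightarrow> norm (iterated_kernel h i x y) \<le> B i"
    using iterated_kernel_summable_bound[OF h] by blast
  have "bounded (w ` {c..b})"
    using w by (intro compact_imp_bounded compact_continuous_image) auto
  then obtain W where W: "0 < W" "\<And>z. z \<in> {c..b} \<Longrightarrow> norm (w z) \<le> W"
    unfolding bounded_pos by auto
  have iter: "w x = volterra (iterated_kernel h i) c w x" if "x \<in> {c..b}" for i x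
    using that
  proof (induction i arbitrary: x)
    case (Suc i)
    have "w x = volterra h c w x" by (rule eq[OF Suc.prems])
    also have "\<dots> = volterra h c (volterra (iterated_kernel h i) c w) x"
      using Suc.prems by (intro volterra_cong Suc.IH) auto
    also have "\<dots> = volterra (iterated_kernel h (Suc i)) c w x"
      unfolding iterated_kernel_Suc
      using Suc.prems by (intro volterra_volterra[OF h continuous_iterated_kernel[OF h] w]) simp
    finally show ?case .
  qed (use eq in simp)
  have "norm (w x) \<le> B i * W * (x - c)" for i
  proof -
    have "norm (volterra (iterated_kernel h i) c w x) \<le> B i * W * (x - c)"
      unfolding volterra_def
    proof (rule integral_bound)
      show "continuous_on {c..x} (\<lambda>z. iterated_kernel h i x z * w z)"
        using x by (intro continuous_intros continuous_on_subset[OF w]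
            continuous_kernel_compose[OF continuous_iterated_kernel[OF h]]) auto
      show "norm (iterated_kernel h i x z * w z) \<le> B i * W" if "z \<in> {c..x}" for z
      proof -
        have "(x, z) \<in> Delta c b" "z \<in> {c..b}" using that x by (auto simp: Delta_def)
        then show ?thesis unfolding norm_mult
          by (intro mult_mono B(2) W(2)) (auto intro: order_trans[OF _ B(2)])
      qed
    qed (use x in auto)
    then show ?thesis using iter[OF x, of i] by simp
  qed
  moreover have "(\<lambda>i. B i * W * (x - c)) \<longlonglongrightarrow> 0 * W * (x - c)"
    by (intro tendsto_intros summable_LIMSEQ_zero B(1))
  ultimately have "norm (w x) \<le> 0 * W * (x - c)"
    by (intro tendsto_lowerbound[where F = sequentially]) auto
  then show ?thesis by simp
qed

section \<open>Functions with vanishing initial derivatives\<close>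
lemma has_integral_deriv_on:
  assumes "Cn_on n a b \<phi>" "k < n" "x \<in> {a..b}"
  shows "((deriv_on a b ^^ Suc k) \<phi> has_integral
    (deriv_on a b ^^ k) \<phi> x - (deriv_on a b ^^ k) \<phi> a) {a..x}"
proof (rule fundamental_theorem_of_calculus)
  show "((deriv_on a b ^^ k) \<phi> has_vector_derivative (deriv_on a b ^^ Suc k) \<phi> t)
      (at t within {a..x})" if "t \<in> {a..x}" for t
  proof -
    have "(deriv_on a b ^^ k) \<phi> differentiable (at t within {a..b})"
      using assms that by (auto simp: Cn_on_def)
    then have "((deriv_on a b ^^ k) \<phi> has_vector_derivative (deriv_on a b ^^ Suc k) \<phi> t)
        (at t within {a..b})"
      by (simp add: vector_derivative_works deriv_on_def)
    then show ?thesis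
      by (rule has_vector_derivative_within_subset) (use assms in auto)
  qed
qed (use assms in auto)

text \<open>Any chain of successive one-sided derivatives computes the iterates of \<^const>\<open>deriv_on\<close>,
  because at points of a nondegenerate interval the derivative within it is unique.\<close>
lemma deriv_on_iterates:
  assumes "a < b" and \<phi>: "\<And>x. x \<in> {a..b} \<Longrightarrow> \<phi> x = d 0 x"
    and d: "\<And>k x. k < n \<Longrightarrow> x \<in> {a..b} \<Longrightarrow>
      (d k has_vector_derivative d (Suc k) x) (at x within {a..b})"
    and "k \<le> n" "x \<in> {a..b}"
  shows "(deriv_on a b ^^ k) \<phi> x = d k x"
  using assms(4,5)
proof (induction k arbitrary: x)
  case (Suc k)
  have "((deriv_on a b ^^ k) \<phi> has_vector_derivative d (Suc k) x) (at x within {a..b})"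
    by (rule has_vector_derivative_transform[OF _ _ d]) (use Suc in auto)
  then show ?case
    unfolding funpow.simps o_def deriv_on_def[of a b "(deriv_on a b ^^ k) \<phi>"]
    using Suc.prems \<open>a < b\<close> by (intro vector_derivative_within_closed_interval) auto
qed (use \<phi> in simp)

lemma Cn_on_derivatives:
  assumes "a < b" and \<phi>: "\<And>x. x \<in> {a..b} \<Longrightarrow> \<phi> x = d 0 x"
    and d: "\<And>k x. k < n \<Longrightarrow> x \<in> {a..b} \<Longrightarrow>
      (d k has_vector_derivative d (Suc k) x) (at x within {a..b})"
    and "continuous_on {a..b} (d n)"
  shows "Cn_on n a b \<phi>"
proof -
  note iterates = deriv_on_iterates[of a b \<phi> d n, OF assms(1-3)]
  have deriv: "((deriv_on a b ^^ k) \<phi> has_vector_derivative d (Suc k) x) (at x within {a..b})"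
    if "k < n" "x \<in> {a..b}" for k x
    by (rule has_vector_derivative_transform[OF _ _ d]) (use that iterates in auto)
  have "continuous_on {a..b} ((deriv_on a b ^^ k) \<phi>)" if "k \<le> n" for k
  proof (cases "k = n")
    case True
    then show ?thesis
      using assms(4) iterates by (subst continuous_on_cong[OF refl]) auto
  next
    case False
    then show ?thesis
      using that by (intro continuous_on_vector_derivative[where f' = "d (Suc k)"] deriv) auto
  qed
  moreover have "(deriv_on a b ^^ k) \<phi> differentiable (at x within {a..b})"
    if "k < n" "x \<in> {a..b}" for k x
    using deriv[OF that] by (rule differentiableI_vector)
  ultimately show ?thesis by (simp add: Cn_on_def)
qed

text \<open>The successive derivatives of the \<open>n\<close>-fold integral of \<open>u\<close> from \<open>c\<close>. The last one has to
  be given separately, since the identity has no kernel.\<close>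
definition taylor_derivs :: "nat \<Rightarrow> real \<Rightarrow> (real \<Rightarrow> complex) \<Rightarrow> nat \<Rightarrow> real \<Rightarrow> complex" where
  "taylor_derivs n c u k = (if k < n then volterra (taylor_kernel (n - k - 1)) c u else u)"

lemma taylor_derivs_has_derivative:
  assumes "continuous_on {c..b} u" "k < n" "x \<in> {c..b}"
  shows "(taylor_derivs n c u k has_vector_derivative taylor_derivs n c u (Suc k) x)
    (at x within {c..b})"
proof (cases "Suc k < n")
  case True
  then have "n - k - 1 = Suc (n - Suc k - 1)" by simp
  then show ?thesis
    using True assms by (simp add: taylor_derivs_def volterra_taylor_has_derivative(1))
next
  case False
  then have "n = Suc k" using assms by simp
  then show ?thesis
    using assms by (simp add: taylor_derivs_def volterra_taylor_has_derivative(2))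
qed

lemma taylor_derivs_deriv_on:
  assumes "a < b" "continuous_on {a..b} u" "\<And>x. x \<in> {a..b} \<Longrightarrow> \<phi> x = taylor_derivs n a u 0 x"
  shows "\<phi> \<in> D_space n a b"
    and "k \<le> n \<Longrightarrow> x \<in> {a..b} \<Longrightarrow> (deriv_on a b ^^ k) \<phi> x = taylor_derivs n a u k x"
proof -
  show iterates: "(deriv_on a b ^^ k) \<phi> x = taylor_derivs n a u k x"
    if "k \<le> n" "x \<in> {a..b}" for k x
    using that assms by (intro deriv_on_iterates taylor_derivs_has_derivative) auto
  have "Cn_on n a b \<phi>"
    using assms by (intro Cn_on_derivatives[of a b \<phi> "taylor_derivs n a u"]
        taylor_derivs_has_derivative) (auto simp: taylor_derivs_def)
  moreover have "(deriv_on a b ^^ k) \<phi> a = 0" if "k < n" for k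
    using iterates[of k a] that \<open>a < b\<close> by (simp add: taylor_derivs_def volterra_def)
  ultimately show "\<phi> \<in> D_space n a b" by (simp add: D_space_def)
qed

text \<open>Taylor's formula with integral remainder: the Taylor polynomial at \<open>a\<close> is zero because of
  the initial conditions.\<close>
lemma D_space_taylor_derivs:
  assumes "\<phi> \<in> D_space n a b" "k \<le> n" "x \<in> {a..b}"
  shows "(deriv_on a b ^^ k) \<phi> x = taylor_derivs n a ((deriv_on a b ^^ n) \<phi>) k x"
proof -
  define u where "u = (deriv_on a b ^^ n) \<phi>"
  have Cn: "Cn_on n a b \<phi>" and zero: "\<And>k. k < n \<Longrightarrow> (deriv_on a b ^^ k) \<phi> a = 0"
    using assms(1) by (auto simp: D_space_def)
  have u: "continuous_on {a..b} u"
    using Cn by (simp add: Cn_on_def u_def)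
  have int: "(deriv_on a b ^^ k) \<phi> x = integral {a..x} ((deriv_on a b ^^ Suc k) \<phi>)"
    if "k < n" "x \<in> {a..b}" for k x
    using integral_unique[OF has_integral_deriv_on[OF Cn that]] zero[OF that(1)] by simp
  have "(deriv_on a b ^^ (n - j - 1)) \<phi> x = volterra (taylor_kernel j) a u x"
    if "j < n" "x \<in> {a..b}" for j x
    using that
  proof (induction j arbitrary: x)
    case 0
    then have "Suc (n - 1) = n" by simp
    then show ?case
      using int[of "n - 1" x] 0 by (simp add: volterra_def u_def del: funpow.simps)
  next
    case (Suc j)
    then have eq: "Suc (n - Suc j - 1) = n - j - 1" by simp
    have "(deriv_on a b ^^ (n - Suc j - 1)) \<phi> x =
        integral {a..x} ((deriv_on a b ^^ (n - j - 1)) \<phi>)"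
      using int[of "n - Suc j - 1" x] Suc.prems unfolding eq by simp
    also have "\<dots> = integral {a..x} (volterra (taylor_kernel j) a u)"
      using Suc by (intro integral_cong) auto
    also have "\<dots> = volterra (taylor_kernel (Suc j)) a u x"
      using volterra_taylor_Suc[OF u, of x j] Suc.prems by simp
    finally show ?case .
  qed
  from this[of "n - k - 1" x] have "(deriv_on a b ^^ k) \<phi> x = taylor_derivs n a u k x"
    using assms(2,3) by (cases "k < n") (auto simp: taylor_derivs_def u_def)
  then show ?thesis by (simp add: u_def)
qed

section \<open>Reduction to a Volterra equation\<close>
lemma ide_kernel_mult:
  assumes "P n x \<noteq> 0"
  shows "P n x * ide_kernel n P f x y =
    - (\<Sum>k<n. P k x * taylor_kernel (n - k - 1) x y) - kernel_comp f (taylor_kernel (n - 1)) x y"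
proof -
  have "integral {y..x} (\<lambda>z. f x z / P n x * complex_of_real ((z - y) ^ (n - 1) / fact (n - 1))) =
      integral {y..x} (\<lambda>z. 1 / P n x * (f x z * taylor_kernel (n - 1) z y))"
    by (simp add: taylor_kernel_def)
  also have "\<dots> = 1 / P n x * kernel_comp f (taylor_kernel (n - 1)) x y"
    unfolding kernel_comp_def volterra_def by (rule integral_mult_right)
  finally show ?thesis
    using assms
    by (simp add: ide_kernel_def right_diff_distrib sum_distrib_left taylor_kernel_def)
qed

lemma continuous_ide_kernel:
  assumes P: "\<And>k. k \<le> n \<Longrightarrow> continuous_on {a..b} (P k)"
    and nz: "\<And>x. x \<in> {a..b} \<Longrightarrow> P n x \<noteq> 0" and f: "continuous_kernel a b f"
  shows "continuous_kernel a b (ide_kernel n P f)"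
proof -
  have P': "continuous_on (Delta a b) (\<lambda>p. P k (fst p))" if "k \<le> n" for k
    by (rule continuous_on_compose2[OF P[OF that]])
      (auto intro!: continuous_intros simp: Delta_def)
  have "continuous_on (Delta a b) (\<lambda>p. (- (\<Sum>k<n. P k (fst p) *
      (case p of (x, y) \<Rightarrow> taylor_kernel (n - k - 1) x y)) -
      (case p of (x, y) \<Rightarrow> kernel_comp f (taylor_kernel (n - 1)) x y)) / P n (fst p))"
    using nz
    by (intro continuous_intros P' continuous_taylor_kernel continuous_kernel_comp f)
      (auto simp: Delta_def)
  then show ?thesis
  proof (rule continuous_on_eq)
    fix p assume "p \<in> Delta a b"
    then have "P n (fst p) \<noteq> 0" by (intro nz) (auto simp: Delta_def)
    from ide_kernel_mult[of P n, OF this, of f "snd p"] this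
    show "(- (\<Sum>k<n. P k (fst p) * (case p of (x, y) \<Rightarrow> taylor_kernel (n - k - 1) x y)) -
        (case p of (x, y) \<Rightarrow> kernel_comp f (taylor_kernel (n - 1)) x y)) / P n (fst p) =
        (case p of (x, y) \<Rightarrow> ide_kernel n P f x y)"
      by (simp add: case_prod_beta divide_eq_eq mult.commute)
  qed
qed

text \<open>The kernel \<open>h\<close> is made for this identity: substituting the \<open>n\<close>-fold integral of \<open>u\<close> for the
  unknown function turns the integro-differential operator into \<open>P\<^sub>n (u - h u)\<close>. The base point
  is kept variable because the equation for \<open>T\<close> needs it at \<open>y\<close>.\<close>
lemma ide_operator_taylor_derivs:
  assumes "1 \<le> n" and nz: "P n x \<noteq> 0" and f: "continuous_kernel c b f"
    and u: "continuous_on {c..b} u" and x: "x \<in> {c..b}"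
  shows "(\<Sum>k\<le>n. P k x * taylor_derivs n c u k x) + volterra f c (taylor_derivs n c u 0) x =
    P n x * (u x - volterra (ide_kernel n P f) c u x)"
proof -
  let ?K = taylor_kernel and ?h = "ide_kernel n P f"
  let ?C = "kernel_comp f (?K (n - 1))"
  have int: "((\<lambda>z. k x z * u z) has_integral volterra k c u x) {c..x}"
    if "continuous_kernel c b k" for k
    unfolding volterra_def using volterra_integrable[OF that u] x by auto
  have "((\<lambda>z. - (\<Sum>k<n. P k x * (?K (n - k - 1) x z * u z)) - ?C x z * u z) has_integral
      - (\<Sum>k<n. P k x * volterra (?K (n - k - 1)) c u x) - volterra ?C c u x) {c..x}"
    by (intro has_integral_diff has_integral_neg has_integral_sum has_integral_mult_right int
        continuous_taylor_kernel continuous_kernel_comp f) auto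
  also have "(\<lambda>z. - (\<Sum>k<n. P k x * (?K (n - k - 1) x z * u z)) - ?C x z * u z) =
      (\<lambda>z. P n x * (?h x z * u z))"
    using ide_kernel_mult[of P n, OF nz, of f]
    by (simp only: fun_eq_iff sum_distrib_right left_diff_distrib mult_minus_left
        mult.assoc[symmetric] simp_thms)
  finally have "integral {c..x} (\<lambda>z. P n x * (?h x z * u z)) =
      - (\<Sum>k<n. P k x * volterra (?K (n - k - 1)) c u x) - volterra ?C c u x"
    by (rule integral_unique)
  then have "P n x * volterra ?h c u x =
      - (\<Sum>k<n. P k x * volterra (?K (n - k - 1)) c u x) - volterra ?C c u x"
    by (simp only: integral_mult_right volterra_def[of ?h])
  moreover have "volterra ?C c u x = volterra f c (taylor_derivs n c u 0) x"
    using volterra_volterra[OF f continuous_taylor_kernel u] x \<open>1 \<le> n\<close>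
    by (simp add: taylor_derivs_def)
  moreover have "(\<Sum>k\<le>n. P k x * taylor_derivs n c u k x) =
      (\<Sum>k<n. P k x * volterra (?K (n - k - 1)) c u x) + P n x * u x"
    by (simp add: taylor_derivs_def flip: lessThan_Suc_atMost)
  ultimately show ?thesis by (simp add: right_diff_distrib)
qed

text \<open>The \<open>k\<close>-th derivative of \<open>T\<close> in \<open>x\<close>: for fixed \<open>y\<close>, \<open>T\<close> is up to a factor the sum of a
  power and the \<open>n\<close>-fold integral of \<open>R(\<cdot>, y)\<close>, and the \<open>n\<close>-th derivative of the power is zero.\<close>
definition T_deriv ::
    "nat \<Rightarrow> (nat \<Rightarrow> real \<Rightarrow> complex) \<Rightarrow> (real \<Rightarrow> real \<Rightarrow> complex) \<Rightarrow> nat \<Rightarrow> real \<Rightarrow> real \<Rightarrow> complex" where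
  "T_deriv n P f k x y = 1 / P n y *
    ((if k < n then taylor_kernel (n - k - 1) x y else 0) +
     taylor_derivs n y (\<lambda>z. resolvent_kernel (ide_kernel n P f) z y) k x)"

lemma T_deriv_0: "1 \<le> n \<Longrightarrow> T_deriv n P f 0 = T_kernel n P f"
  by (simp add: T_deriv_def T_kernel_def taylor_derivs_def volterra_def taylor_kernel_def fun_eq_iff)

lemma has_partial_x_T_deriv:
  assumes P: "continuous_on {a..b} (P n)" and nz: "\<And>x. x \<in> {a..b} \<Longrightarrow> P n x \<noteq> 0"
    and h: "continuous_kernel a b (ide_kernel n P f)" and k: "k < n"
  shows "has_partial_x a b (T_deriv n P f k) (T_deriv n P f (Suc k))"
proof -
  define R where "R = resolvent_kernel (ide_kernel n P f)"
  have R: "continuous_kernel a b R"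
    unfolding R_def by (rule continuous_resolvent_kernel[OF h])
  have "continuous_kernel a b (\<lambda>x y. taylor_derivs n y (\<lambda>z. R z y) (Suc k) x)"
  proof (cases "Suc k < n")
    case True
    then show ?thesis
      using continuous_kernel_comp[OF continuous_taylor_kernel R]
      by (simp add: taylor_derivs_def kernel_comp_def)
  qed (use R in \<open>simp add: taylor_derivs_def\<close>)
  moreover have "continuous_kernel a b
      (\<lambda>x y. if Suc k < n then taylor_kernel (n - Suc k - 1) x y else 0)"
    by (cases "Suc k < n") (use continuous_taylor_kernel in auto)
  moreover have "continuous_on (Delta a b) (\<lambda>p. P n (snd p))"
    by (rule continuous_on_compose2[OF P]) (auto intro!: continuous_intros simp: Delta_def)
  ultimately have "continuous_kernel a b (T_deriv n P f (Suc k))"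
    unfolding T_deriv_def R_def[symmetric] case_prod_beta
    by (intro continuous_intros) (auto intro!: nz simp: Delta_def)
  moreover have "((\<lambda>s. T_deriv n P f k s y) has_vector_derivative T_deriv n P f (Suc k) x y)
      (at x within {y..b})" if "(x, y) \<in> Delta a b" for x y
  proof -
    have y: "a \<le> y" "x \<in> {y..b}" using that by (auto simp: Delta_def)
    have "continuous_on {y..b} (\<lambda>z. R z y)"
      using y by (intro continuous_kernel_compose[OF R] continuous_intros) auto
    then have "(taylor_derivs n y (\<lambda>z. R z y) k has_vector_derivative
        taylor_derivs n y (\<lambda>z. R z y) (Suc k) x) (at x within {y..b})"
      using k y by (intro taylor_derivs_has_derivative) auto
    moreover have "((\<lambda>s. if k < n then taylor_kernel (n - k - 1) s y else 0) has_vector_derivative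
        (if Suc k < n then taylor_kernel (n - Suc k - 1) x y else 0)) (at x within {y..b})"
    proof (cases "Suc k < n")
      case True
      then have "n - k - 1 = Suc (n - Suc k - 1)" by simp
      then show ?thesis using True k by (simp add: taylor_kernel_has_derivative)
    next
      case False
      then have "n = Suc k" using k by simp
      then show ?thesis by simp
    qed
    ultimately show ?thesis
      unfolding T_deriv_def R_def[symmetric]
      by (intro has_vector_derivative_mult_right has_vector_derivative_add) auto
  qed
  ultimately show ?thesis by (auto simp: has_partial_x_def)
qed

text \<open>The power in \<open>T\<close> contributes \<open>-h(x, y)\<close> and the \<open>n\<close>-fold integral of \<open>r = R(\<cdot>, y)\<close>
  contributes \<open>r - h r\<close>, both with the factor \<open>P\<^sub>n(x) / P\<^sub>n(y)\<close>. They cancel by the resolvent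
  equation.\<close>
lemma T_deriv_equation:
  assumes "1 \<le> n" and nz: "P n x \<noteq> 0"
    and h: "continuous_kernel a b (ide_kernel n P f)" and f: "continuous_kernel a b f"
    and xy: "(x, y) \<in> Delta a b"
  shows "(\<Sum>k\<le>n. P k x * T_deriv n P f k x y) +
    volterra f y (\<lambda>z. T_deriv n P f 0 z y) x = 0"
proof -
  let ?K = taylor_kernel and ?h = "ide_kernel n P f"
  define r where "r z = resolvent_kernel ?h z y" for z
  have r_eta: "(\<lambda>z. resolvent_kernel ?h z y) = r" by (simp add: r_def fun_eq_iff)
  let ?D = "taylor_derivs n y r"
  have y: "a \<le> y" "x \<in> {y..b}" "x \<le> b" using xy by (auto simp: Delta_def)
  have f': "continuous_kernel y b f"
    using continuous_kernel_subset[OF f y(1)] by simp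
  have r: "continuous_on {y..b} r"
    unfolding r_def using y
    by (intro continuous_kernel_compose[OF continuous_resolvent_kernel[OF h]] continuous_intros) auto
  have K: "continuous_on {y..b} (\<lambda>z. ?K (n - 1) z y)"
    by (intro continuous_kernel_compose[OF continuous_taylor_kernel[of y b]] continuous_intros) auto
  have D: "continuous_on {y..b} (?D 0)"
    using \<open>1 \<le> n\<close> r by (simp add: taylor_derivs_def continuous_on_volterra continuous_taylor_kernel)
  have "(\<Sum>k\<le>n. P k x * T_deriv n P f k x y) =
      1 / P n y * ((\<Sum>k<n. P k x * ?K (n - k - 1) x y) + (\<Sum>k\<le>n. P k x * ?D k x))"
  proof -
    let ?K' = "\<lambda>k. if k < n then ?K (n - k - 1) x y else 0"
    have "P k x * T_deriv n P f k x y = 1 / P n y * (P k x * ?K' k + P k x * ?D k x)" for k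
      unfolding T_deriv_def r_eta by (simp only: distrib_left mult.left_commute)
    then have "(\<Sum>k\<le>n. P k x * T_deriv n P f k x y) =
        1 / P n y * ((\<Sum>k\<le>n. P k x * ?K' k) + (\<Sum>k\<le>n. P k x * ?D k x))"
      by (simp only: sum_distrib_left sum.distrib distrib_left)
    also have "(\<Sum>k\<le>n. P k x * ?K' k) = (\<Sum>k<n. P k x * ?K (n - k - 1) x y)"
      by (simp flip: lessThan_Suc_atMost)
    finally show ?thesis .
  qed
  moreover have "volterra f y (\<lambda>z. T_deriv n P f 0 z y) x =
      1 / P n y * (kernel_comp f (?K (n - 1)) x y + volterra f y (?D 0) x)"
  proof -
    have "volterra f y (\<lambda>z. T_deriv n P f 0 z y) x =
        integral {y..x} (\<lambda>z. 1 / P n y * (f x z * (?K (n - 1) z y + ?D 0 z)))"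
      using \<open>1 \<le> n\<close> by (simp add: volterra_def T_deriv_def r_eta)
    also have "\<dots> = 1 / P n y * volterra f y (\<lambda>z. ?K (n - 1) z y + ?D 0 z) x"
      unfolding volterra_def by (rule integral_mult_right)
    also have "volterra f y (\<lambda>z. ?K (n - 1) z y + ?D 0 z) x =
        volterra f y (\<lambda>z. ?K (n - 1) z y) x + volterra f y (?D 0) x"
      by (rule volterra_add[OF f' K D y(3)])
    finally show ?thesis by (simp add: kernel_comp_def)
  qed
  ultimately have "(\<Sum>k\<le>n. P k x * T_deriv n P f k x y) +
      volterra f y (\<lambda>z. T_deriv n P f 0 z y) x =
      1 / P n y * (((\<Sum>k<n. P k x * ?K (n - k - 1) x y) + kernel_comp f (?K (n - 1)) x y) +
        ((\<Sum>k\<le>n. P k x * ?D k x) + volterra f y (?D 0) x))"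
    by (simp only: distrib_left add.assoc add.left_commute)
  also have "(\<Sum>k\<le>n. P k x * ?D k x) + volterra f y (?D 0) x =
      P n x * (r x - volterra ?h y r x)"
    by (rule ide_operator_taylor_derivs[of n P x, OF \<open>1 \<le> n\<close> nz f' r y(2)])
  also have "r x - volterra ?h y r x = ?h x y"
    using resolvent_equation[OF h xy] by (simp add: r_def[abs_def] kernel_comp_def)
  also note ide_kernel_mult[of P n x f y, OF nz]
  finally show ?thesis by simp
qed

lemma T_deriv_diagonal:
  assumes "k < n"
  shows "T_deriv n P f k x x = (if k = n - 1 then 1 / P n x else 0)"
  using assms by (auto simp: T_deriv_def taylor_derivs_def volterra_def taylor_kernel_diagonal)

text \<open>So \<open>y\<^sub>2\<close> is the \<open>n\<close>-fold integral of the function \<open>G + R G\<close> that solves \<open>u = G + h u\<close>.\<close>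
lemma volterra_T_kernel:
  assumes P: "continuous_on {a..b} (P n)" and nz: "\<And>x. x \<in> {a..b} \<Longrightarrow> P n x \<noteq> 0"
    and h: "continuous_kernel a b (ide_kernel n P f)" and g: "continuous_on {a..b} g"
    and x: "x \<in> {a..b}"
  defines "G \<equiv> \<lambda>z. g z / P n z"
  shows "volterra (T_kernel n P f) a g x = volterra (taylor_kernel (n - 1)) a
    (\<lambda>z. G z + volterra (resolvent_kernel (ide_kernel n P f)) a G z) x"
proof -
  let ?K = "taylor_kernel (n - 1)" and ?R = "resolvent_kernel (ide_kernel n P f)"
  note R = continuous_resolvent_kernel[OF h] and K = continuous_taylor_kernel
  have G: "continuous_on {a..b} G"
    unfolding G_def using nz by (intro continuous_intros P g) auto
  have "volterra (T_kernel n P f) a g x =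
      volterra (\<lambda>x z. ?K x z + kernel_comp ?K ?R x z) a G x"
    unfolding volterra_def
    by (intro integral_cong)
      (simp add: T_kernel_def G_def kernel_comp_def volterra_def taylor_kernel_def)
  also have "\<dots> = volterra ?K a G x + volterra (kernel_comp ?K ?R) a G x"
    using x by (intro volterra_add_kernel[OF K continuous_kernel_comp[OF K R] G]) simp
  also have "volterra (kernel_comp ?K ?R) a G x = volterra ?K a (volterra ?R a G) x"
    using x by (intro volterra_volterra[OF K R G, symmetric]) simp
  also have "volterra ?K a G x + \<dots> = volterra ?K a (\<lambda>z. G z + volterra ?R a G z) x"
    using x by (intro volterra_add[OF K G continuous_on_volterra[OF R G], symmetric]) simp
  finally show ?thesis .
qed

section \<open>Existence, uniqueness and the fundamental kernel\<close>
theorem mainTheorem7: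
  fixes a b :: real and n :: nat
    and P :: "nat \<Rightarrow> real \<Rightarrow> complex"
    and f :: "real \<Rightarrow> real \<Rightarrow> complex"
    and g :: "real \<Rightarrow> complex"
  assumes "a < b" and "n \<ge> 1"
    and "\<And>k. k \<le> n \<Longrightarrow> P k \<in> B1 a b"
    and "\<And>x. x \<in> {a..b} \<Longrightarrow> P n x \<noteq> 0"
    and "f \<in> B2 a b"
    and "continuous_on {a..b} g"
  defines "T \<equiv> T_kernel n P f"
  defines "y\<^sub>2 \<equiv> (\<lambda>x. integral {a..x} (\<lambda>z. T x z * g z))"
  shows "is_ide_solution a b n P f g y\<^sub>2 \<and>
    (\<forall>\<phi>. is_ide_solution a b n P f g \<phi> \<longrightarrow> (\<forall>x\<in>{a..b}. \<phi> x = y\<^sub>2 x)) \<and>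
    (\<exists>dT :: nat \<Rightarrow> real \<Rightarrow> real \<Rightarrow> complex.
       dT 0 = T \<and>
       (\<forall>k<n. has_partial_x a b (dT k) (dT (Suc k))) \<and>
       (\<forall>(x, y)\<in>Delta a b.
          (\<Sum>k\<le>n. P k x * dT k x y) + integral {y..x} (\<lambda>z. f x z * T z y) = 0) \<and>
       (\<forall>x\<in>{a..b}. (\<forall>i. i + 2 \<le> n \<longrightarrow> dT i x x = 0) \<and> dT (n - 1) x x = 1 / P n x))"
proof (intro conjI)
  let ?h = "ide_kernel n P f"
  have P: "continuous_on {a..b} (P k)" if "k \<le> n" for k
    using assms(3)[OF that] by (force simp: B1_def Cn_on_def)
  have nz: "P n x \<noteq> 0" if "x \<in> {a..b}" for x using assms(4) that .
  have f: "continuous_kernel a b f"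
    using assms(5) by (auto simp: B2_def dest: spec[of _ 0])
  have h: "continuous_kernel a b ?h"
    by (rule continuous_ide_kernel[where P = P and n = n, OF P nz f])
  note R = continuous_resolvent_kernel[OF h]
  define G where "G z = g z / P n z" for z
  have G: "continuous_on {a..b} G"
    unfolding G_def using nz by (intro continuous_intros P assms(6)) auto
  define u where "u z = G z + volterra (resolvent_kernel ?h) a G z" for z
  have u: "continuous_on {a..b} u"
    unfolding u_def by (intro continuous_intros G continuous_on_volterra[OF R G])
  have u_eq: "u x = G x + volterra ?h a u x" if "x \<in> {a..b}" for x
    using volterra_resolvent[OF h G that] by (simp add: u_def[abs_def])
  have y2: "y\<^sub>2 x = taylor_derivs n a u 0 x" if "x \<in> {a..b}" for x
    using volterra_T_kernel[of a b P n f g x, OF P nz h assms(6) that] \<open>n \<ge> 1\<close>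
    by (simp add: y\<^sub>2_def T_def taylor_derivs_def u_def[abs_def] G_def[abs_def] volterra_def[abs_def])
  \<comment> \<open>Used twice: with \<open>u\<close> for existence and with the \<open>n\<close>-th derivative of a solution for
    uniqueness.\<close>
  have equation: "(\<Sum>k\<le>n. P k x * (deriv_on a b ^^ k) \<phi> x) + integral {a..x} (\<lambda>z. f x z * \<phi> z) =
      P n x * (v x - volterra ?h a v x)"
    if v: "continuous_on {a..b} v" and x: "x \<in> {a..b}"
      and derivs: "\<And>k x. k \<le> n \<Longrightarrow> x \<in> {a..b} \<Longrightarrow>
        (deriv_on a b ^^ k) \<phi> x = taylor_derivs n a v k x" for \<phi> v x
  proof -
    have "integral {a..x} (\<lambda>z. f x z * \<phi> z) = volterra f a (taylor_derivs n a v 0) x"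
      unfolding volterra_def using x derivs[of 0] by (intro integral_cong) auto
    then show ?thesis
      using ide_operator_taylor_derivs[of n P x, OF \<open>n \<ge> 1\<close> nz[OF x] f v x] derivs x by simp
  qed
  show "is_ide_solution a b n P f g y\<^sub>2"
    unfolding is_ide_solution_def
  proof (intro conjI ballI)
    show "y\<^sub>2 \<in> D_space n a b"
      by (rule taylor_derivs_deriv_on(1)[OF \<open>a < b\<close> u y2])
    show "(\<Sum>k\<le>n. P k x * (deriv_on a b ^^ k) y\<^sub>2 x) + integral {a..x} (\<lambda>z. f x z * y\<^sub>2 z) = g x"
      if "x \<in> {a..b}" for x
      using equation[OF u that taylor_derivs_deriv_on(2)[OF \<open>a < b\<close> u y2]]
        u_eq[OF that] nz[OF that] by (simp add: G_def)
  qed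
  show "\<forall>\<phi>. is_ide_solution a b n P f g \<phi> \<longrightarrow> (\<forall>x\<in>{a..b}. \<phi> x = y\<^sub>2 x)"
  proof (intro allI impI ballI)
    fix \<phi> x
    assume \<phi>: "is_ide_solution a b n P f g \<phi>" and x: "x \<in> {a..b}"
    define v where "v = (deriv_on a b ^^ n) \<phi>"
    have D: "\<phi> \<in> D_space n a b" using \<phi> by (simp add: is_ide_solution_def)
    then have v: "continuous_on {a..b} v" by (simp add: v_def D_space_def Cn_on_def)
    have derivs: "(deriv_on a b ^^ k) \<phi> x = taylor_derivs n a v k x"
      if "k \<le> n" "x \<in> {a..b}" for k x
      unfolding v_def by (rule D_space_taylor_derivs[OF D that])
    have v_eq: "v t = G t + volterra ?h a v t" if t: "t \<in> {a..b}" for t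
    proof -
      have "P n t * (v t - volterra ?h a v t) = g t"
        using equation[OF v t derivs] \<phi> t by (simp add: is_ide_solution_def)
      then show ?thesis using nz[OF t] by (simp add: G_def field_simps)
    qed
    have "v t = u t" if "t \<in> {a..b}" for t
    proof -
      have "v t - u t = 0"
      proof (rule volterra_homogeneous_unique[OF h _ _ that])
        show "continuous_on {a..b} (\<lambda>t. v t - u t)" by (intro continuous_intros u v)
        show "v t - u t = volterra ?h a (\<lambda>t. v t - u t) t" if "t \<in> {a..b}" for t
          using volterra_diff[OF h v u, of t] v_eq[OF that] u_eq[OF that] that by simp
      qed
      then show ?thesis by simp
    qed
    then have "taylor_derivs n a v 0 x = taylor_derivs n a u 0 x"
      using x \<open>n \<ge> 1\<close> by (auto simp: taylor_derivs_def intro!: volterra_cong)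
    then show "\<phi> x = y\<^sub>2 x" using derivs[of 0 x] y2[OF x] x by simp
  qed
  show "\<exists>dT. dT 0 = T \<and>
       (\<forall>k<n. has_partial_x a b (dT k) (dT (Suc k))) \<and>
       (\<forall>(x, y)\<in>Delta a b.
          (\<Sum>k\<le>n. P k x * dT k x y) + integral {y..x} (\<lambda>z. f x z * T z y) = 0) \<and>
       (\<forall>x\<in>{a..b}. (\<forall>i. i + 2 \<le> n \<longrightarrow> dT i x x = 0) \<and> dT (n - 1) x x = 1 / P n x)"
  proof (intro exI[of _ "T_deriv n P f"] conjI allI impI ballI; (clarify)?)
    show T0: "T_deriv n P f 0 = T" using T_deriv_0[OF \<open>n \<ge> 1\<close>] by (simp add: T_def)
    show "has_partial_x a b (T_deriv n P f k) (T_deriv n P f (Suc k))" if "k < n" for k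
      by (rule has_partial_x_T_deriv[of a b P n f k, OF P nz h that]) simp_all
    show "(\<Sum>k\<le>n. P k x * T_deriv n P f k x y) + integral {y..x} (\<lambda>z. f x z * T z y) = 0"
      if "(x, y) \<in> Delta a b" for x y
      using T_deriv_equation[of n P x a b f y, OF \<open>n \<ge> 1\<close> nz h f that] that
      by (simp add: T0 volterra_def Delta_def)
    show "T_deriv n P f i x x = 0" if "i + 2 \<le> n" for i x
      using that by (simp add: T_deriv_diagonal)
    show "T_deriv n P f (n - 1) x x = 1 / P n x" for x
      using \<open>n \<ge> 1\<close> by (simp add: T_deriv_diagonal)
  qed
qed

end
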